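(* Let $G$ be a graph with empty $n$-core. Then $\mathrm{mlt}(G)\le n$.
   Context: $G$ is a finite simple undirected graph on $V=[m]$. The $n$-core of $G$ is the graph obtained from $G$ by successively deleting vertices of degree $<n$; $G$ has empty $n$-core if this process deletes all vertices. With $Sym(m,n)$ the symmetric $m\times m$ matrices of rank at most $n$, $\mathbb{S}^m_{\ge0}$ / $\mathbb{S}^m_{>0}$ the positive semidefinite / definite matrices, and $\phi_G(\Sigma)=(\sigma_{ii})_{i\in V}\oplus(\sigma_{ij})_{ij\in E}$, the maximum likelihood threshold $\mathrm{mlt}(G)$ is the smallest $n$ such that for almost all $\Sigma_0\in Sym(m,n)\cap\mathbb{S}^m_{\ge0}$ (equivalently $\Sigma_0=P^TP$ for Lebesgue-almost all $P\in\mathbb{R}^{n\times m}$) there is $\Sigma\in\mathbb{S}^m_{>0}$ with $\phi_G(\Sigma_0)=\phi_G(\Sigma)$. *)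

theory Defs
  imports "HOL-Analysis.Analysis"
begin

text \<open>
  A simple undirected graph on the vertex set \<^term>\<open>UNIV :: 'm set\<close> is a symmetric irreflexive
  relation \<open>E\<close>; the edge \<open>ij\<close> is represented by both pairs \<open>(i, j)\<close> and \<open>(j, i)\<close>.
\<close>

definition deletion_step :: "('m \<times> 'm) set \<Rightarrow> nat \<Rightarrow> 'm set \<Rightarrow> 'm set \<Rightarrow> bool" where
  "deletion_step E n S S' \<longleftrightarrow> (\<exists>v\<in>S. card (E `` {v} \<inter> S) < n \<and> S' = S - {v})"

definition empty_core :: "('m \<times> 'm) set \<Rightarrow> nat \<Rightarrow> bool" where
  "empty_core E n \<longleftrightarrow> (deletion_step E n)\<^sup>*\<^sup>* UNIV {}"

definition positive_definite :: "real ^ 'm ^ 'm \<Rightarrow> bool" where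
  "positive_definite A \<longleftrightarrow> transpose A = A \<and> (\<forall>x. x \<noteq> 0 \<longrightarrow> x \<bullet> (A *v x) > 0)"

text \<open>
  On symmetric matrices the two coordinates \<open>(i, j)\<close> and \<open>(j, i)\<close> belonging to one edge agree,
  so no information beyond one entry per edge is recorded.
\<close>

definition graph_proj ::
    "('m \<times> 'm) set \<Rightarrow> real ^ 'm ^ 'm \<Rightarrow> (real ^ 'm) \<times> ('m \<times> 'm \<Rightarrow> real)" where
  "graph_proj E A = ((\<chi> i. A $ i $ i), (\<lambda>(i, j)\<in>E. A $ i $ j))"

text \<open>
  Since \<open>n\<close> varies, an \<open>n \<times> m\<close> matrix \<open>P\<close> is a function on the index set \<open>{..<n} \<times> UNIV\<close>;
  \<open>gram n P\<close> is the matrix \<open>P\<^sup>T P\<close>.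
\<close>

definition gram :: "nat \<Rightarrow> (nat \<times> 'm \<Rightarrow> real) \<Rightarrow> real ^ 'm ^ 'm" where
  "gram n P = (\<chi> i j. \<Sum>k<n. P (k, i) * P (k, j))"

definition lebesgue_matrices :: "nat \<Rightarrow> (nat \<times> 'm::finite \<Rightarrow> real) measure" where
  "lebesgue_matrices n = Pi\<^sub>M ({..<n} \<times> UNIV) (\<lambda>_. lborel)"

text \<open>
  The minimum is attained: for \<open>n = CARD('m)\<close> almost every \<open>P\<^sup>T P\<close> is itself positive definite.
\<close>

definition mlt :: "('m::finite \<times> 'm) set \<Rightarrow> nat" where
  "mlt E = (LEAST n. AE P in lebesgue_matrices n.
     \<exists>A. positive_definite A \<and> graph_proj E (gram n P) = graph_proj E A)"

end

theory Submission
  imports Defs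
begin

text \<open>
  By separation of convex sets, a partial matrix carried by \<open>P\<^sup>T P\<close> has a positive definite
  completion unless there is a nonzero positive semidefinite \<open>K\<close> that vanishes off the diagonal
  and the edges and satisfies \<open>K P\<^sup>T = 0\<close>. For almost every \<open>P\<close> any \<open>n\<close> columns of \<open>P\<close> are
  linearly independent. Row \<open>v\<close> of \<open>K P\<^sup>T = 0\<close> is a linear relation among the columns of \<open>P\<close> at \<open>v\<close>
  and its neighbours, so if \<open>v\<close> has degree less than \<open>n\<close>, row \<open>v\<close> of \<open>K\<close> vanishes; one then
  deletes \<open>v\<close> and repeats. An empty \<open>n\<close>-core thus forces \<open>K = 0\<close>.
\<close>

subsection \<open>Generic linear independence of columns\<close>

lemma measurable_det:
  fixes M :: "'a \<Rightarrow> real ^ 'm ^ 'm"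
  assumes "\<And>i j. (\<lambda>x. M x $ i $ j) \<in> borel_measurable N"
  shows "(\<lambda>x. det (M x)) \<in> borel_measurable N"
  unfolding det_def using assms by measurable

text \<open>Fubini in coordinate \<open>i\<close>: every line parallel to that axis meets the set
  where \<open>R\<close> holds and \<open>Q\<close> fails in at most one point, so this set is null,
  and \<open>R\<close> itself fails only on a null set.\<close>

lemma AE_PiM_coordinatewise:
  fixes Q R :: "('i \<Rightarrow> real) \<Rightarrow> bool"
  assumes I: "finite I" "i \<in> I"
    and Q: "Measurable.pred (Pi\<^sub>M I (\<lambda>_. lborel)) Q"
    and R: "Measurable.pred (Pi\<^sub>M I (\<lambda>_. lborel)) R"
    and AE: "AE x in Pi\<^sub>M I (\<lambda>_. lborel). R x"
    and unique: "\<And>x s t. R (x(i := s)) \<Longrightarrow> R (x(i := t)) \<Longrightarrow>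
        \<not> Q (x(i := s)) \<Longrightarrow> \<not> Q (x(i := t)) \<Longrightarrow> s = t"
  shows "AE x in Pi\<^sub>M I (\<lambda>_. lborel). Q x"
proof -
  interpret product_sigma_finite "\<lambda>_::'i. lborel :: real measure" ..
  let ?M = "\<lambda>J. Pi\<^sub>M J (\<lambda>_::'i. lborel :: real measure)"
  have ins: "I = insert i (I - {i})" using I by auto
  define f :: "('i \<Rightarrow> real) \<Rightarrow> ennreal" where "f x = (if R x \<and> \<not> Q x then 1 else 0)" for x
  have f: "f \<in> borel_measurable (?M I)"
    unfolding f_def using Q R by measurable
  have inner: "(\<integral>\<^sup>+ t. f (x(i := t)) \<partial>lborel) = 0" for x
  proof -
    have "\<exists>s. \<forall>t. R (x(i := t)) \<and> \<not> Q (x(i := t)) \<longrightarrow> t = s"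
      using unique by blast
    then obtain s where s: "\<And>t. R (x(i := t)) \<and> \<not> Q (x(i := t)) \<Longrightarrow> t = s" by blast
    have "(\<integral>\<^sup>+ t. f (x(i := t)) \<partial>lborel) \<le> (\<integral>\<^sup>+ t. indicator {s} t \<partial>lborel)"
      by (intro nn_integral_mono) (use s in \<open>auto simp: f_def indicator_def\<close>)
    also have "\<dots> = 0" by simp
    finally show ?thesis by simp
  qed
  have "(\<integral>\<^sup>+ x. f x \<partial>?M I) = (\<integral>\<^sup>+ x. (\<integral>\<^sup>+ t. f (x(i := t)) \<partial>lborel) \<partial>?M (I - {i}))"
    using product_nn_integral_insert[of "I - {i}" i f] I f ins by simp
  then have "(\<integral>\<^sup>+ x. f x \<partial>?M I) = 0" by (simp add: inner)
  then have "AE x in ?M I. f x = 0"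
    using f by (simp add: nn_integral_0_iff_AE)
  with AE show ?thesis
    by eventually_elim (auto simp: f_def split: if_splits)
qed

text \<open>The square submatrix of \<open>P\<close> with rows \<open>f i\<close> and columns
  \<open>j\<close> for indices in \<open>N\<close>, padded by an identity block. The padding keeps
  the index type \<open>'m\<close> fixed while \<open>N\<close> grows, and leaves the determinant of
  the submatrix unchanged.\<close>

definition minor_matrix :: "('m \<Rightarrow> nat) \<Rightarrow> 'm set \<Rightarrow> (nat \<times> 'm \<Rightarrow> real) \<Rightarrow> real ^ 'm ^ 'm" where
  "minor_matrix f N P =
     (\<chi> i j. if i \<in> N then if j \<in> N then P (f i, j) else 0 else if i = j then 1 else 0)"

text \<open>The identity rows kill the entries outside \<open>N\<close>; what remains are linear
  relations among the columns in \<open>N\<close>. Minors can thus be handled through kernels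
  instead of cofactor expansions.\<close>

lemma minor_matrix_kernel_iff:
  fixes c :: "real ^ 'm::finite"
  shows "minor_matrix f N P *v c = 0 \<longleftrightarrow>
    (\<forall>j. j \<notin> N \<longrightarrow> c $ j = 0) \<and> (\<forall>i\<in>N. (\<Sum>j\<in>N. c $ j * P (f i, j)) = 0)"
proof -
  have entry: "(minor_matrix f N P *v c) $ i =
      (if i \<in> N then \<Sum>j\<in>N. c $ j * P (f i, j) else c $ i)" for i
  proof (cases "i \<in> N")
    case True
    then have "(minor_matrix f N P *v c) $ i = (\<Sum>j\<in>UNIV. if j \<in> N then c $ j * P (f i, j) else 0)"
      by (auto simp: minor_matrix_def matrix_vector_mult_def intro!: sum.cong)
    also have "\<dots> = (\<Sum>j\<in>N. c $ j * P (f i, j))"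
      by (simp add: sum.If_cases)
    finally show ?thesis using True by simp
  next
    case False
    then have "(minor_matrix f N P *v c) $ i = (\<Sum>j\<in>UNIV. if i = j then c $ j else 0)"
      unfolding minor_matrix_def matrix_vector_mult_def vec_lambda_beta
      by (intro sum.cong) auto
    then show ?thesis using False by simp
  qed
  show ?thesis unfolding vec_eq_iff entry zero_index by (auto split: if_splits)
qed

lemma det_nonzero_iff_kernel:
  fixes A :: "real ^ 'm ^ 'm"
  shows "det A \<noteq> 0 \<longleftrightarrow> (\<forall>c. A *v c = 0 \<longrightarrow> c = 0)"
  by (metis invertible_det_nz invertible_left_inverse matrix_left_invertible_ker)

lemma measurable_det_minor_matrix:
  fixes N :: "'m::finite set"
  assumes "\<And>i. i \<in> N \<Longrightarrow> f i < n"
  shows "(\<lambda>P. det (minor_matrix f N P)) \<in> borel_measurable (Pi\<^sub>M ({..<n} \<times> UNIV) (\<lambda>_. lborel))"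
proof (rule measurable_det)
  fix i j :: 'm
  show "(\<lambda>P. minor_matrix f N P $ i $ j) \<in> borel_measurable (Pi\<^sub>M ({..<n} \<times> UNIV) (\<lambda>_. lborel))"
  proof (cases "i \<in> N \<and> j \<in> N")
    case True
    then have "(\<lambda>P. P (f i, j)) \<in> measurable (Pi\<^sub>M ({..<n} \<times> UNIV) (\<lambda>_. lborel)) lborel"
      using assms by (intro measurable_component_singleton) auto
    then show ?thesis using True by (simp add: minor_matrix_def)
  next
    case False
    then show ?thesis by (cases "i \<in> N") (simp_all add: minor_matrix_def)
  qed
qed

text \<open>Induction on \<open>N\<close>: the larger minor is affine in the new corner entry
  \<open>P (f v, v)\<close>, with the smaller minor as slope. Where that slope is nonzero, at most
  one value of the corner makes the larger minor vanish.\<close>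

lemma AE_det_minor_matrix_nonzero:
  fixes N :: "'m::finite set"
  assumes "inj_on f N" and "\<And>i. i \<in> N \<Longrightarrow> f i < n"
  shows "AE P in Pi\<^sub>M ({..<n} \<times> UNIV) (\<lambda>_. lborel). det (minor_matrix f N P) \<noteq> 0"
  using finite[of N] assms
proof (induction N rule: finite_induct)
  case empty
  have "minor_matrix f {} P = mat 1" for P :: "nat \<times> 'm \<Rightarrow> real"
    by (simp add: minor_matrix_def mat_def vec_eq_iff)
  then show ?case by simp
next
  case (insert v N)
  let ?M = "Pi\<^sub>M ({..<n} \<times> (UNIV :: 'm set)) (\<lambda>_. lborel :: real measure)"
  have meas: "(\<lambda>P. det (minor_matrix f N P)) \<in> borel_measurable ?M"
      "(\<lambda>P. det (minor_matrix f (insert v N) P)) \<in> borel_measurable ?M"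
    using insert.prems by (auto intro!: measurable_det_minor_matrix)
  show ?case
  proof (rule AE_PiM_coordinatewise[where i = "(f v, v)"])
    show "AE P in ?M. det (minor_matrix f N P) \<noteq> 0"
      using insert by (auto simp: inj_on_insert)
    fix P :: "nat \<times> 'm \<Rightarrow> real" and s t
    assume N: "det (minor_matrix f N (P((f v, v) := s))) \<noteq> 0"
      and bad: "\<not> det (minor_matrix f (insert v N) (P((f v, v) := s))) \<noteq> 0"
        "\<not> det (minor_matrix f (insert v N) (P((f v, v) := t))) \<noteq> 0"
    \<comment> \<open>The updated coordinate enters the larger minor only at its corner: rows from
      \<open>N\<close> avoid \<open>f v\<close>, and columns from \<open>N\<close> avoid
      \<open>v\<close>.\<close>
    have fv: "f i \<noteq> f v" if "i \<in> N" for i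
      using insert.prems(1) insert.hyps(2) that by (auto simp: inj_on_def)
    have jv: "j \<noteq> v" if "j \<in> N" for j using that insert.hyps by auto
    have inj: "c = 0"
      if "\<And>j. j \<notin> N \<Longrightarrow> c $ j = 0" "\<And>i. i \<in> N \<Longrightarrow> (\<Sum>j\<in>N. c $ j * P (f i, j)) = 0"
      for c :: "real ^ 'm"
    proof -
      have "(\<Sum>j\<in>N. c $ j * (P((f v, v) := s)) (f i, j)) = (\<Sum>j\<in>N. c $ j * P (f i, j))" for i
        using jv by (intro sum.cong) auto
      then have "minor_matrix f N (P((f v, v) := s)) *v c = 0"
        unfolding minor_matrix_kernel_iff using that by auto
      then show ?thesis using N det_nonzero_iff_kernel by blast
    qed
    \<comment> \<open>A singular larger minor has a kernel vector. Its entry at \<open>v\<close> is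
      nonzero, since otherwise \<open>inj\<close> would annihilate it, so it can be scaled to 1. Row
      \<open>f v\<close> then expresses the corner value \<open>u\<close> through the
      vector.\<close>
    have normalized: "\<exists>c :: real ^ 'm. c $ v = 1 \<and> (\<forall>j. j \<notin> insert v N \<longrightarrow> c $ j = 0) \<and>
        (\<forall>i\<in>N. P (f i, v) + (\<Sum>j\<in>N. c $ j * P (f i, j)) = 0) \<and>
        u + (\<Sum>j\<in>N. c $ j * P (f v, j)) = 0"
      if "\<not> det (minor_matrix f (insert v N) (P((f v, v) := u))) \<noteq> 0" for u
    proof -
      have "\<exists>c. minor_matrix f (insert v N) (P((f v, v) := u)) *v c = 0 \<and> c \<noteq> 0"
        using that unfolding det_nonzero_iff_kernel by simp
      then obtain c :: "real ^ 'm" where c0: "c \<noteq> 0"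
        and c: "minor_matrix f (insert v N) (P((f v, v) := u)) *v c = 0"
        by auto
      have out: "\<And>j. j \<notin> insert v N \<Longrightarrow> c $ j = 0"
        and eq: "\<And>i. i \<in> insert v N \<Longrightarrow>
          (\<Sum>j\<in>insert v N. c $ j * (P((f v, v) := u)) (f i, j)) = 0"
        using c[unfolded minor_matrix_kernel_iff] by (auto simp del: sum.insert fun_upd_apply)
      have sumN: "(\<Sum>j\<in>N. c $ j * (P((f v, v) := u)) (f i, j)) = (\<Sum>j\<in>N. c $ j * P (f i, j))" for i
        using jv by (intro sum.cong) auto
      have eqN: "c $ v * P (f i, v) + (\<Sum>j\<in>N. c $ j * P (f i, j)) = 0" if "i \<in> N" for i
        using eq[of i] that fv[OF that] insert.hyps sumN[of i] by simp
      have eqv: "c $ v * u + (\<Sum>j\<in>N. c $ j * P (f v, j)) = 0"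
        using eq[of v] insert.hyps sumN[of v] by simp
      have cv: "c $ v \<noteq> 0"
      proof
        assume v0: "c $ v = 0"
        have "c = 0"
        proof (rule inj)
          show "c $ j = 0" if "j \<notin> N" for j
            using v0 out that by (cases "j = v") auto
        qed (use v0 eqN in auto)
        then show False using c0 by simp
      qed
      have scale: "(\<Sum>j\<in>N. ((1 / c $ v) *\<^sub>R c) $ j * P (k, j)) =
          (\<Sum>j\<in>N. c $ j * P (k, j)) / c $ v" for k
        by (simp add: sum_divide_distrib)
      show ?thesis
        by (rule exI[of _ "(1 / c $ v) *\<^sub>R c"], unfold scale)
          (use cv out eqN eqv in \<open>auto simp: field_simps\<close>)
    qed
    obtain c :: "real ^ 'm" where c: "c $ v = 1" "\<And>j. j \<notin> insert v N \<Longrightarrow> c $ j = 0"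
        "\<And>i. i \<in> N \<Longrightarrow> P (f i, v) + (\<Sum>j\<in>N. c $ j * P (f i, j)) = 0"
        "s + (\<Sum>j\<in>N. c $ j * P (f v, j)) = 0"
      using normalized[OF bad(1)] by blast
    obtain d :: "real ^ 'm" where d: "d $ v = 1" "\<And>j. j \<notin> insert v N \<Longrightarrow> d $ j = 0"
        "\<And>i. i \<in> N \<Longrightarrow> P (f i, v) + (\<Sum>j\<in>N. d $ j * P (f i, j)) = 0"
        "t + (\<Sum>j\<in>N. d $ j * P (f v, j)) = 0"
      using normalized[OF bad(2)] by blast
    \<comment> \<open>Both vectors solve the same equations in the rows from \<open>N\<close>, which
      do not see the corner, and their entries at \<open>v\<close> cancel. Equal vectors then give
      equal corner values.\<close>
    have "c - d = 0"
    proof (rule inj)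
      show "(c - d) $ j = 0" if "j \<notin> N" for j
        using that c(1,2) d(1,2) by (cases "j = v") auto
      show "(\<Sum>j\<in>N. (c - d) $ j * P (f i, j)) = 0" if "i \<in> N" for i
        using c(3)[OF that] d(3)[OF that] by (simp add: left_diff_distrib sum_subtractf)
    qed
    then show "s = t" using c(4) d(4) by simp
  qed (use insert.prems meas in auto)
qed

text \<open>At most \<open>n\<close> columns can be matched injectively with rows, so a generic
  minor excludes a relation among them. There are finitely many sets \<open>N\<close>, hence one
  null set serves all of them.\<close>

lemma AE_columns_independent:
  "AE P in lebesgue_matrices n. \<forall>(N :: 'm::finite set) (c :: real ^ 'm).
     card N \<le> n \<longrightarrow> (\<forall>j. j \<notin> N \<longrightarrow> c $ j = 0) \<longrightarrow>
     (\<forall>k<n. (\<Sum>j\<in>UNIV. c $ j * P (k, j)) = 0) \<longrightarrow> c = 0"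
proof -
  have "AE P in lebesgue_matrices n. card N \<le> n \<longrightarrow> (\<forall>c :: real ^ 'm.
     (\<forall>j. j \<notin> N \<longrightarrow> c $ j = 0) \<longrightarrow>
     (\<forall>k<n. (\<Sum>j\<in>UNIV. c $ j * P (k, j)) = 0) \<longrightarrow> c = 0)" for N :: "'m set"
  proof (cases "card N \<le> n")
    case True
    obtain f where f: "inj_on f N" "f ` N \<subseteq> {..<n}"
      using card_le_inj[of N "{..<n}"] True by auto
    have "AE P in lebesgue_matrices n. det (minor_matrix f N P) \<noteq> 0"
      unfolding lebesgue_matrices_def
      using f by (intro AE_det_minor_matrix_nonzero) auto
    then show ?thesis
    proof eventually_elim
      case (elim P)
      show ?case
      proof (intro impI allI)
        fix c :: "real ^ 'm"
        assume out: "\<forall>j. j \<notin> N \<longrightarrow> c $ j = 0"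
          and eq: "\<forall>k<n. (\<Sum>j\<in>UNIV. c $ j * P (k, j)) = 0"
        have "(\<Sum>j\<in>N. c $ j * P (k, j)) = (\<Sum>j\<in>UNIV. c $ j * P (k, j))" for k
          using out by (intro sum.mono_neutral_left) auto
        then have "minor_matrix f N P *v c = 0"
          unfolding minor_matrix_kernel_iff using out eq f(2) by auto
        then show "c = 0" using elim det_nonzero_iff_kernel by blast
      qed
    qed
  qed simp
  then have "AE P in lebesgue_matrices n. \<forall>N\<in>(UNIV :: 'm set set). card N \<le> n \<longrightarrow> (\<forall>c :: real ^ 'm.
     (\<forall>j. j \<notin> N \<longrightarrow> c $ j = 0) \<longrightarrow>
     (\<forall>k<n. (\<Sum>j\<in>UNIV. c $ j * P (k, j)) = 0) \<longrightarrow> c = 0)"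
    by (intro AE_finite_allI) auto
  then show ?thesis by eventually_elim blast
qed

subsection \<open>Positive definite completions\<close>

lemma inner_matrix: "(A :: real ^ 'm ^ 'm::finite) \<bullet> B = (\<Sum>i\<in>UNIV. \<Sum>j\<in>UNIV. A $ i $ j * B $ i $ j)"
  by (simp add: inner_vec_def)

lemma quadratic_form_sum:
  "(x :: real ^ 'm::finite) \<bullet> (A *v x) = (\<Sum>i\<in>UNIV. \<Sum>j\<in>UNIV. A $ i $ j * (x $ i * x $ j))"
  by (simp add: inner_vec_def matrix_vector_mult_def sum_distrib_left mult_ac)

text \<open>Pairing with these rank-one matrices turns a quadratic form into a linear functional of
  its matrix, which links separation in matrix space to semidefiniteness.\<close>

definition outer_square :: "real ^ 'm \<Rightarrow> real ^ 'm ^ 'm" where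
  "outer_square y = (\<chi> i j. y $ i * y $ j)"

lemma inner_outer_square: "A \<bullet> outer_square y = y \<bullet> (A *v y)" for y :: "real ^ 'm::finite"
  by (simp add: inner_matrix quadratic_form_sum outer_square_def)

lemma quadratic_form_outer_square:
  "x \<bullet> (outer_square y *v x) = (y \<bullet> x)\<^sup>2" for y :: "real ^ 'm::finite"
  unfolding quadratic_form_sum unfolding outer_square_def
  by (simp add: inner_vec_def power2_eq_square sum_product mult_ac)

lemma gram_eq_sum_outer_square:
  "gram n P = (\<Sum>k<n. outer_square (\<chi> i. P (k, i)))"
  by (simp add: gram_def outer_square_def vec_eq_iff)

text \<open>A zero \<open>x\<close> of the form is a minimum, but a small move along
  \<open>- (A *v x)\<close> would decrease the form to first order if \<open>A *v x\<close> were
  nonzero.\<close>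

lemma psd_kernel:
  fixes A :: "real ^ 'm ^ 'm::finite"
  assumes sym: "transpose A = A" and psd: "\<And>y. 0 \<le> y \<bullet> (A *v y)" and x: "x \<bullet> (A *v x) = 0"
  shows "A *v x = 0"
proof (rule ccontr)
  define z where "z = A *v x"
  assume "A *v x \<noteq> 0"
  then have z: "z \<bullet> z > 0" by (simp add: z_def)
  define q where "q = z \<bullet> (A *v z)"
  \<comment> \<open>This step length makes the quadratic term \<open>s * q\<close> at most
    \<open>z \<bullet> z\<close>, half of the linear gain; the 1 in the denominator covers
    \<open>q = 0\<close>.\<close>
  define s where "s = (z \<bullet> z) / (q + 1)"
  have q: "q \<ge> 0" using psd by (simp add: q_def)
  then have s: "s > 0" using z by (simp add: s_def)
  have xz: "x \<bullet> (A *v z) = z \<bullet> z"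
    by (metis dot_lmul_matrix inner_commute sym transpose_matrix_vector z_def)
  have "x \<bullet> z = 0" using x by (simp add: z_def)
  then have "(x - s *\<^sub>R z) \<bullet> (A *v (x - s *\<^sub>R z)) = s * (s * q - 2 * (z \<bullet> z))"
    by (simp add: matrix_vector_mult_diff_distrib matrix_vector_mult_scaleR
        inner_diff_left inner_diff_right xz q_def[symmetric] z_def[symmetric] algebra_simps)
  moreover have "s * q \<le> z \<bullet> z"
    using q z by (simp add: s_def field_simps)
  then have "s * (s * q - 2 * (z \<bullet> z)) < 0"
    using s z by (intro mult_pos_neg) linarith+
  ultimately show False using psd[of "x - s *\<^sub>R z"] by simp
qed

lemma affine_bounded_above_imp_zero:
  fixes p q b :: real
  assumes "\<And>t. p + t * q \<le> b"
  shows "q = 0"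
proof (rule ccontr)
  assume "q \<noteq> 0"
  then show False using assms[of "(b - p + 1) / q"] by simp
qed

lemma affine_bounded_below_imp_nonneg:
  fixes p q b :: real
  assumes "\<And>t. t \<ge> 0 \<Longrightarrow> b \<le> p + t * q"
  shows "q \<ge> 0"
proof (rule ccontr)
  assume q: "\<not> q \<ge> 0"
  have "b \<le> p" using assms[of 0] by simp
  then have "(b - p - 1) / q \<ge> 0" using q by (simp add: divide_nonpos_neg)
  then show False using assms[of "(b - p - 1) / q"] q by simp
qed

text \<open>
  Both convex sets are taken in the space of all matrices rather than the symmetric ones: the
  skew-symmetric directions of the affine set then force the separating functional to be symmetric.
\<close>

lemma completion_or_stress:
  fixes E :: "('m::finite \<times> 'm) set"
  assumes E: "sym E"
  shows "(\<exists>A. positive_definite A \<and> graph_proj E (gram n P) = graph_proj E A) \<or>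
    (\<exists>K :: real ^ 'm ^ 'm. K \<noteq> 0 \<and> transpose K = K \<and>
      (\<forall>i j. i \<noteq> j \<longrightarrow> (i, j) \<notin> E \<longrightarrow> K $ i $ j = 0) \<and>
      (\<forall>k<n. K *v (\<chi> i. P (k, i)) = 0))"
proof -
  define G where "G = gram n P"
  have G_sym: "G $ j $ i = G $ i $ j" for i j
    by (simp add: G_def gram_def mult.commute)
  define S :: "(real ^ 'm ^ 'm) set" where "S = {B. \<forall>x. x \<noteq> 0 \<longrightarrow> x \<bullet> (B *v x) > 0}"
  define T :: "(real ^ 'm ^ 'm) set"
    where "T = {B. \<forall>i j. i = j \<or> (i, j) \<in> E \<longrightarrow> B $ i $ j + B $ j $ i = 2 * G $ i $ j}"
  show ?thesis
  proof (cases "S \<inter> T = {}")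
    case False
    then obtain B where S: "B \<in> S" and T: "B \<in> T" by blast
    \<comment> \<open>Symmetrizing keeps the quadratic form, and membership in \<open>T\<close>
      prescribes exactly the symmetric part on the diagonal and the edges.\<close>
    define A where "A = (1 / 2) *\<^sub>R (B + transpose B)"
    have "x \<bullet> (transpose B *v x) = x \<bullet> (B *v x)" for x
      by (metis dot_lmul_matrix inner_commute transpose_matrix_vector)
    then have "x \<bullet> (A *v x) = x \<bullet> (B *v x)" for x
      by (simp add: A_def matrix_vector_mult_add_rdistrib scaleR_matrix_vector_assoc[symmetric]
          inner_add_right)
    moreover have "transpose A = A"
      by (simp add: A_def transpose_def vec_eq_iff add.commute)
    ultimately have "positive_definite A"
      using S by (simp add: positive_definite_def S_def)
    moreover have "A $ i $ j = G $ i $ j" if "i = j \<or> (i, j) \<in> E" for i j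
    proof -
      have "B $ i $ j + B $ j $ i = 2 * G $ i $ j" using T that unfolding T_def by blast
      then show ?thesis by (simp add: A_def transpose_def)
    qed
    then have "graph_proj E (gram n P) = graph_proj E A"
      by (auto simp: graph_proj_def G_def[symmetric] vec_eq_iff restrict_def)
    ultimately show ?thesis by blast
  next
    case True
    \<comment> \<open>Test matrices for the separation: the identity summand moves a rank-one matrix
      into the set \<open>S\<close> of strictly positive forms.\<close>
    have S_mem: "t *\<^sub>R outer_square y + s *\<^sub>R mat 1 \<in> S" if "t \<ge> 0" "s > 0" for t s y
      using that
      by (auto simp: S_def matrix_vector_mult_add_rdistrib scaleR_matrix_vector_assoc[symmetric]
          inner_add_right quadratic_form_outer_square intro!: add_nonneg_pos)
    have G_T: "G \<in> T" using G_sym by (simp add: T_def)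
    have convex_S: "convex S"
    proof (rule convexI)
      fix A B and u v :: real
      assume A: "A \<in> S" and B: "B \<in> S" and uv: "0 \<le> u" "0 \<le> v" "u + v = 1"
      show "u *\<^sub>R A + v *\<^sub>R B \<in> S"
        unfolding S_def
      proof (intro CollectI allI impI)
        fix x :: "real ^ 'm" assume "x \<noteq> 0"
        then have "x \<bullet> (A *v x) > 0" "x \<bullet> (B *v x) > 0" using A B by (auto simp: S_def)
        then have "u * (x \<bullet> (A *v x)) + v * (x \<bullet> (B *v x)) > 0"
          using uv by (cases "u = 0") (auto intro!: add_pos_nonneg)
        then show "x \<bullet> ((u *\<^sub>R A + v *\<^sub>R B) *v x) > 0"
          by (simp add: matrix_vector_mult_add_rdistrib scaleR_matrix_vector_assoc[symmetric]
              inner_add_right)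
      qed
    qed
    have convex_T: "convex T"
    proof (rule convexI)
      fix A B and u v :: real
      assume A: "A \<in> T" and B: "B \<in> T" and uv: "u + v = 1"
      show "u *\<^sub>R A + v *\<^sub>R B \<in> T"
        unfolding T_def
      proof (intro CollectI allI impI)
        fix i j :: 'm assume "i = j \<or> (i, j) \<in> E"
        then have "A $ i $ j + A $ j $ i = 2 * G $ i $ j" "B $ i $ j + B $ j $ i = 2 * G $ i $ j"
          using A B by (auto simp: T_def)
        then have "u * (A $ i $ j + A $ j $ i) + v * (B $ i $ j + B $ j $ i) = (u + v) * (2 * G $ i $ j)"
          by (simp add: distrib_right)
        then show "(u *\<^sub>R A + v *\<^sub>R B) $ i $ j + (u *\<^sub>R A + v *\<^sub>R B) $ j $ i = 2 * G $ i $ j"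
          using uv by (simp add: algebra_simps)
      qed
    qed
    have "S \<noteq> {}" using S_mem[of 0 1] by auto
    then obtain K b where K0: "K \<noteq> 0"
      and KT: "\<And>B. B \<in> T \<Longrightarrow> K \<bullet> B \<le> b" and KS: "\<And>B. B \<in> S \<Longrightarrow> K \<bullet> B \<ge> b"
      using separating_hyperplane_sets[OF convex_T convex_S] G_T True by blast
    \<comment> \<open>\<open>T\<close> is affine and \<open>K\<close> is bounded above on it, so
      \<open>K\<close> is constant along every line in \<open>T\<close>.\<close>
    have direction: "K \<bullet> D = 0"
      if "\<And>i j. i = j \<or> (i, j) \<in> E \<Longrightarrow> D $ i $ j + D $ j $ i = 0" for D
    proof (rule affine_bounded_above_imp_zero)
      fix t :: real
      have "G + t *\<^sub>R D \<in> T"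
        unfolding T_def
      proof (intro CollectI allI impI)
        fix i j :: 'm assume "i = j \<or> (i, j) \<in> E"
        then have "t * (D $ i $ j + D $ j $ i) = 0" using that by simp
        then show "(G + t *\<^sub>R D) $ i $ j + (G + t *\<^sub>R D) $ j $ i = 2 * G $ i $ j"
          using G_sym[of i j] by (simp add: distrib_left)
      qed
      then show "K \<bullet> G + t * (K \<bullet> D) \<le> b"
        using KT[of "G + t *\<^sub>R D"] by (simp add: inner_add_right)
    qed
    have entry: "K \<bullet> axis i (axis j 1) = K $ i $ j" for i j
      by (simp add: inner_axis)
    have pattern: "K $ i $ j = 0" if "i \<noteq> j" "(i, j) \<notin> E" for i j
    proof -
      \<comment> \<open>The condition defining \<open>T\<close> at \<open>(j, i)\<close> also
        involves the entry at \<open>(i, j)\<close>, so both pairs must be non-edges for this entry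
        to be free.\<close>
      have "(j, i) \<notin> E" using that E by (auto dest: symD)
      then have "K \<bullet> axis i (axis j 1) = 0"
        using that by (intro direction) (auto simp: axis_def)
      then show ?thesis by (simp add: entry)
    qed
    have K_sym: "K $ i $ j = K $ j $ i" for i j
    proof -
      have "K \<bullet> (axis i (axis j 1) - axis j (axis i 1)) = 0"
        by (intro direction) (auto simp: axis_def)
      then show ?thesis by (simp add: inner_diff_right entry)
    qed
    have KS': "b \<le> s * (K \<bullet> mat 1) + t * (y \<bullet> (K *v y))" if "t \<ge> 0" "s > 0" for s t y
      using KS[OF S_mem[OF that, of y]] by (simp add: inner_add_right inner_outer_square)
    \<comment> \<open>Fix \<open>s = 1\<close> and let \<open>t\<close> grow: a negative slope would
      break the lower bound \<open>b\<close>.\<close>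
    have psd: "0 \<le> y \<bullet> (K *v y)" for y
      using KS'[of _ 1 y] by (intro affine_bounded_below_imp_nonneg) auto
    \<comment> \<open>Now take \<open>t = 0\<close> and let \<open>s\<close> tend to 0.\<close>
    have "b \<le> 0"
    proof (rule field_le_epsilon)
      fix e :: real assume e: "e > 0"
      define s where "s = e / (\<bar>K \<bullet> mat 1\<bar> + 1)"
      have s: "s > 0" using e by (simp add: s_def add_nonneg_pos)
      have "b \<le> s * (K \<bullet> mat 1)" using KS'[of 0 s] s by simp
      also have "\<dots> \<le> s * (\<bar>K \<bullet> mat 1\<bar> + 1)" using s by (intro mult_left_mono) auto
      also have "\<dots> = e" by (simp add: s_def add_nonneg_pos)
      finally show "b \<le> 0 + e" by simp
    qed
    \<comment> \<open>\<open>K \<bullet> G\<close> is a sum of nonnegative values of the form of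
      \<open>K\<close> at the rows of \<open>P\<close>, so this upper bound forces each of them to
      be zero.\<close>
    then have "K \<bullet> G \<le> 0" using KT[OF G_T] by simp
    then have "(\<Sum>k<n. (\<chi> i. P (k, i)) \<bullet> (K *v (\<chi> i. P (k, i)))) \<le> 0"
      by (simp add: G_def gram_eq_sum_outer_square inner_sum_right inner_outer_square)
    then have "(\<Sum>k<n. (\<chi> i. P (k, i)) \<bullet> (K *v (\<chi> i. P (k, i)))) = 0"
      using psd by (intro antisym sum_nonneg) auto
    then have zero: "(\<chi> i. P (k, i)) \<bullet> (K *v (\<chi> i. P (k, i))) = 0" if "k < n" for k
      using psd that by (subst (asm) sum_nonneg_eq_0_iff) auto
    have tr: "transpose K = K" using K_sym by (simp add: transpose_def vec_eq_iff)
    then have "K *v (\<chi> i. P (k, i)) = 0" if "k < n" for k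
      using psd zero[OF that] by (intro psd_kernel)
    with K0 tr pattern show ?thesis by blast
  qed
qed

section \<open>Vertex deletion and the threshold bound\<close>

text \<open>The invariant along the deletions is that rows of \<open>K\<close> at deleted vertices
  vanish. By symmetry so do the columns, hence row \<open>v\<close> is supported on \<open>v\<close>
  and its surviving neighbours.\<close>

lemma stress_zero_if_empty_core:
  fixes E :: "('m::finite \<times> 'm) set" and K :: "real ^ 'm ^ 'm"
  assumes core: "empty_core E n"
    and sym: "transpose K = K"
    and pattern: "\<And>i j. i \<noteq> j \<Longrightarrow> (i, j) \<notin> E \<Longrightarrow> K $ i $ j = 0"
    and stress: "\<And>k. k < n \<Longrightarrow> K *v (\<chi> i. P (k, i)) = 0"
    and indep: "\<And>(N :: 'm set) (c :: real ^ 'm). card N \<le> n \<Longrightarrow> (\<And>j. j \<notin> N \<Longrightarrow> c $ j = 0) \<Longrightarrow>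
      (\<And>k. k < n \<Longrightarrow> (\<Sum>j\<in>UNIV. c $ j * P (k, j)) = 0) \<Longrightarrow> c = 0"
  shows "K = 0"
proof -
  have K_sym: "K $ i $ j = K $ j $ i" for i j
    by (metis sym transpose_def vec_lambda_beta)
  have "(deletion_step E n)\<^sup>*\<^sup>* UNIV S \<Longrightarrow> \<forall>i. i \<notin> S \<longrightarrow> K $ i = 0" for S
  proof (induction rule: rtranclp_induct)
    case base
    show ?case by simp
  next
    case (step S S')
    then obtain v where v: "v \<in> S" "card (E `` {v} \<inter> S) < n" "S' = S - {v}"
      by (auto simp: deletion_step_def)
    have "K $ v = 0"
    proof (rule indep)
      \<comment> \<open>Degree less than \<open>n\<close>, plus \<open>v\<close> itself, gives at
        most \<open>n\<close> columns: exactly the range in which they are independent.\<close>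
      show "card (insert v (E `` {v} \<inter> S)) \<le> n"
        using v(2) by (simp add: card_insert_if)
      show "K $ v $ j = 0" if "j \<notin> insert v (E `` {v} \<inter> S)" for j
      proof (cases "j \<in> S")
        case True
        then show ?thesis using that pattern by auto
      next
        case False
        then show ?thesis using step.IH K_sym[of v j] by simp
      qed
      show "(\<Sum>j\<in>UNIV. K $ v $ j * P (k, j)) = 0" if "k < n" for k
        using arg_cong[OF stress[OF that], of "\<lambda>x. x $ v"] by (simp add: matrix_vector_mult_def)
    qed
    then show ?case using step.IH v(3) by auto
  qed
  then have "\<forall>i. K $ i = 0" using core by (auto simp: empty_core_def)
  then show ?thesis by (simp add: vec_eq_iff)
qed

theorem theorem3p7:
  fixes E :: "('m::finite \<times> 'm) set" and n :: nat
  assumes "sym E" and "irrefl E"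
    and "empty_core E n"
  shows "mlt E \<le> n"
  unfolding mlt_def
proof (rule Least_le)
  show "AE P in lebesgue_matrices n.
      \<exists>A. positive_definite A \<and> graph_proj E (gram n P) = graph_proj E A"
    using AE_columns_independent
  proof eventually_elim
    case (elim P)
    \<comment> \<open>For such \<open>P\<close> every stress is zero, so the alternative between
      completion and stress leaves only the completion.\<close>
    have "K = 0" if K: "transpose K = K" "\<forall>i j. i \<noteq> j \<longrightarrow> (i, j) \<notin> E \<longrightarrow> K $ i $ j = 0"
        "\<forall>k<n. K *v (\<chi> i. P (k, i)) = 0" for K :: "real ^ 'm ^ 'm"
    proof (rule stress_zero_if_empty_core[OF assms(3) K(1), of P])
      show "c = 0" if "card N \<le> n" "\<And>j. j \<notin> N \<Longrightarrow> c $ j = 0"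
          "\<And>k. k < n \<Longrightarrow> (\<Sum>j\<in>UNIV. c $ j * P (k, j)) = 0" for N :: "'m set" and c :: "real ^ 'm"
        using elim that by simp
    qed (use K in simp_all)
    then show ?case using completion_or_stress[OF assms(1), of n P] by blast
  qed
qed

end
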